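(* Fix any edge-probability $p\in(0,1)$ (independent of $n$) and let $b=1/(1-p)$. Then for every $\epsilon\in(0,1)$ there exists a deterministic $3\epsilon$-restricted online algorithm $\mathcal{A}$ such that, as $n\to\infty$, \[ \mathbb{P}_{G\sim\mathbb{G}(n,p)}\Bigl[\bigl|\mathcal{A}(G)\bigr|\ge(1+\epsilon)\log_b(n)\Bigr]=1-o(1). \]
   Context: $\mathbb{G}(n,p)$ is the Erdős–Rényi random graph on vertex set $[n]=\{1,\dots,n\}$ in which each vertex-pair is an edge independently with probability $p$; $\log_b$ is the logarithm to base $b$. A deterministic online algorithm $\mathcal{A}$ runs for $n$ rounds and maintains sets $V_t\subseteq[n]$, $\mathcal{A}_t(G)\subseteq V_t$, $E_t\subseteq\binom{[n]}{2}$, initially empty. In each round $t\in[n]$: (1) based on all information revealed so far, it selects a vertex $v_t\in[n]\setminus V_{t-1}$ and reveals the edge-status of all so-far unrevealed pairs $\{v_t,v\}$ with $v\in V_{t-1}$; (2) based on all information revealed so far, it selects a set $S_t\subseteq\binom{[n]}{2}$ of vertex-pairs (possibly involving vertices not yet selected) and reveals the edge-status of all so-far unrevealed pairs in $S_t$; (3) based on all information revealed so far, it sets either $\mathcal{A}_t(G)=\mathcal{A}_{t-1}(G)\cup\{v_t\}$ or $\mathcal{A}_t(G)=\mathcal{A}_{t-1}(G)$, always ensuring $\mathcal{A}_t(G)$ is an independent set of $G$, and sets $V_t=V_{t-1}\cup\{v_t\}$, $E_t=E_{t-1}\cup S_t$. The output is $\mathcal{A}(G):=\mathcal{A}_n(G)$.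 For $c\ge0$, $\mathcal{A}$ is called $c$-restricted if it always satisfies $\bigl|E_n\cap\binom{\mathcal{A}(G)}{2}\bigr|\le c\log_b^2(np)$, where $\binom{I}{2}$ denotes the set of pairs of distinct elements of $I$. *)

theory Defs
  imports "HOL-Probability.Probability" "HOL-Probability.Product_PMF" "HOL-Library.Ramsey"
begin

text \<open>
  A vertex-pair is a two-element set of naturals, and a graph on the vertex set \<open>{1..n}\<close>
  is identified with its edge set, a subset of \<open>[{1..n}]\<^bsup>2\<^esup>\<close>.
\<close>

type_synonym edge = "nat set"

definition graphs :: "nat \<Rightarrow> edge set set" where
  "graphs n = Pow ([{1..n}]\<^bsup>2\<^esup>)"

definition indep_set :: "nat \<Rightarrow> edge set \<Rightarrow> nat set \<Rightarrow> bool" where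
  "indep_set n G I \<longleftrightarrow> I \<subseteq> {1..n} \<and> [I]\<^bsup>2\<^esup> \<inter> G = {}"

definition random_graph :: "nat \<Rightarrow> real \<Rightarrow> edge set pmf" where
  "random_graph n p =
     map_pmf (\<lambda>f. {e \<in> [{1..n}]\<^bsup>2\<^esup>. f e})
       (Pi_pmf ([{1..n}]\<^bsup>2\<^esup>) False (\<lambda>_. bernoulli_pmf p))"

text \<open>
  Everything a deterministic algorithm knows at a given moment: the selected vertices
  \<open>v\<^sub>t, \<dots>, v\<^sub>1\<close> and the query sets \<open>S\<^sub>t, \<dots>, S\<^sub>1\<close> (both most recent first), the current
  set of accepted vertices, and the edge-status of every vertex-pair revealed so far
  (\<open>None\<close> for unrevealed pairs).  Together these determine the whole history of the run.
\<close>

record info =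
  selected :: "nat list"
  accepted :: "nat set"
  queried  :: "edge set list"
  status   :: "edge \<Rightarrow> bool option"

definition initial_info :: info where
  "initial_info = \<lparr>selected = [], accepted = {}, queried = [], status = (\<lambda>_. None)\<rparr>"

text \<open>
  A strategy makes the three decisions of a round.  Its decisions depend on the graph only
  through the current information; for \<open>choose_pairs\<close> and \<open>accepts\<close> this already includes
  what the preceding steps of the same round have selected and revealed.
\<close>

record strategy =
  choose_vertex :: "info \<Rightarrow> nat"
  choose_pairs  :: "info \<Rightarrow> edge set"
  accepts       :: "info \<Rightarrow> bool"

definition reveal :: "edge set \<Rightarrow> edge set \<Rightarrow> (edge \<Rightarrow> bool option) \<Rightarrow> (edge \<Rightarrow> bool option)" where
  "reveal G R st = (\<lambda>e. if e \<in> R then Some (e \<in> G) else st e)"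

definition step1 :: "strategy \<Rightarrow> edge set \<Rightarrow> info \<Rightarrow> info" where
  "step1 a G s =
     (let v = choose_vertex a s in
      s\<lparr>selected := v # selected s,
        status := reveal G {{v, u} | u. u \<in> set (selected s)} (status s)\<rparr>)"

definition step2 :: "strategy \<Rightarrow> edge set \<Rightarrow> info \<Rightarrow> info" where
  "step2 a G s =
     (let S = choose_pairs a s in
      s\<lparr>queried := S # queried s, status := reveal G S (status s)\<rparr>)"

definition step3 :: "strategy \<Rightarrow> info \<Rightarrow> info" where
  "step3 a s =
     (if accepts a s then s\<lparr>accepted := insert (hd (selected s)) (accepted s)\<rparr> else s)"

primrec run :: "strategy \<Rightarrow> edge set \<Rightarrow> nat \<Rightarrow> info" where
  "run a G 0 = initial_info"
| "run a G (Suc t) = step3 a (step2 a G (step1 a G (run a G t)))"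

definition V_set :: "strategy \<Rightarrow> edge set \<Rightarrow> nat \<Rightarrow> nat set" where
  "V_set a G t = set (selected (run a G t))"

definition A_set :: "strategy \<Rightarrow> edge set \<Rightarrow> nat \<Rightarrow> nat set" where
  "A_set a G t = accepted (run a G t)"

definition E_set :: "strategy \<Rightarrow> edge set \<Rightarrow> nat \<Rightarrow> edge set" where
  "E_set a G t = \<Union> (set (queried (run a G t)))"

text \<open>
  A strategy is an online algorithm for \<open>n\<close>-vertex graphs if on every input its decisions
  in all of the rounds \<open>1, \<dots>, n\<close> (here \<open>Suc t\<close> with \<open>t < n\<close>) are legal.
\<close>

definition online_algorithm :: "nat \<Rightarrow> strategy \<Rightarrow> bool" where
  "online_algorithm n a \<longleftrightarrow>
     (\<forall>G\<in>graphs n. \<forall>t<n.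
        choose_vertex a (run a G t) \<in> {1..n} - V_set a G t \<and>
        choose_pairs a (step1 a G (run a G t)) \<subseteq> [{1..n}]\<^bsup>2\<^esup> \<and>
        indep_set n G (A_set a G (Suc t)))"

definition final_set :: "nat \<Rightarrow> strategy \<Rightarrow> edge set \<Rightarrow> nat set" where
  "final_set n a G = A_set a G n"

definition restricted :: "real \<Rightarrow> nat \<Rightarrow> real \<Rightarrow> strategy \<Rightarrow> bool" where
  "restricted c n p a \<longleftrightarrow>
     (\<forall>G\<in>graphs n.
        real (card (E_set a G n \<inter> [final_set n a G]\<^bsup>2\<^esup>)) \<le> c * (log (1 / (1 - p)) (real n * p))\<^sup>2)"

end

theory Submission
  imports Defs "HOL-Real_Asymp.Real_Asymp"
begin

text \<open>
  With \<open>L = log\<^sub>b n\<close>, fix \<open>\<delta>\<close> slightly larger than \<open>\<epsilon>\<close>. On the vertices \<open>1, \<dots>, m\<close>, about half of all,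
  the greedy algorithm finds an independent set \<open>I\<close> of size \<open>(1 - \<delta>) L\<close>: otherwise it stops at a smaller
  set dominating \<open>{1..m}\<close>, and a union bound excludes such sets. Then all pairs not inside \<open>{1..m}\<close>
  are queried, and the algorithm accepts a set \<open>T\<close> of later vertices with \<open>|T| = (\<epsilon> + \<delta>) L\<close> for which
  \<open>I \<union> T\<close> is independent. The queried pairs are independent of \<open>I\<close>, so the second moment method
  applies to the number of such \<open>T\<close>; it succeeds because \<open>\<delta> > \<epsilon>\<close>. Pairs inside \<open>I\<close> are never queried, so
  about \<open>((1 + \<epsilon>)\<^sup>2 - (1 - \<delta>)\<^sup>2) L\<^sup>2 / 2 < (\<epsilon> + \<delta>) L\<^sup>2\<close> queried pairs lie inside the output, and this is
  less than \<open>3 \<epsilon> L\<^sup>2\<close> if \<open>\<delta> < 2 \<epsilon>\<close>.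
\<close>

section \<open>Product distributions and the second moment method\<close>

text \<open>Conditioning on the first component, by iterated integration. In the application that
  component is the graph on the early vertices, so the extension can be analysed for a fixed greedy
  set.\<close>

lemma prob_pair_pmf_le:
  assumes "\<And>x. x \<in> set_pmf M \<Longrightarrow> measure_pmf.prob N {y. Q x y} \<le> c" and "0 \<le> c"
  shows "measure_pmf.prob (pair_pmf M N) {z. Q (fst z) (snd z)} \<le> c"
proof -
  have "emeasure (pair_pmf M N) {z. Q (fst z) (snd z)} = (\<integral>\<^sup>+x. emeasure N {y. Q x y} \<partial>M)"
    by (simp flip: nn_integral_indicator add: nn_integral_pair_pmf' indicator_def del: nn_integral_indicator)
  also have "\<dots> \<le> (\<integral>\<^sup>+x. ennreal c \<partial>M)"
    using assms by (intro nn_integral_mono_AE)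
      (auto simp: AE_measure_pmf_iff measure_pmf.emeasure_eq_measure ennreal_leI)
  also have "\<dots> = ennreal c"
    by simp
  finally show ?thesis
    using assms(2) by (simp add: measure_pmf.emeasure_eq_measure)
qed

lemma prob_pair_pmf_Times:
  "measure_pmf.prob (pair_pmf M N) (A \<times> B) = measure_pmf.prob M A * measure_pmf.prob N B"
proof -
  have "emeasure (pair_pmf M N) (A \<times> B) = (\<integral>\<^sup>+x. \<integral>\<^sup>+y. indicator A x * indicator B y \<partial>N \<partial>M)"
    by (simp flip: nn_integral_indicator add: nn_integral_pair_pmf' indicator_times)
  also have "\<dots> = emeasure M A * emeasure N B"
    by (simp add: nn_integral_cmult nn_integral_multc)
  finally show ?thesis
    by (simp add: measure_pmf.emeasure_eq_measure flip: ennreal_mult)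
qed

text \<open>If none of the events occurs, their counting function \<open>f\<close> is 0 and so
  differs from its mean \<mu> by at least \<mu>. The hypothesis \<open>pairs\<close> bounds the
  variance of \<open>f\<close> by \<open>d\<close> times the squared mean, and Chebyshev's
  inequality applies.\<close>

lemma second_moment_union:
  fixes A :: "'i \<Rightarrow> 'a set" and d :: real
  assumes "finite X" and pos: "(\<Sum>i\<in>X. measure_pmf.prob M (A i)) > 0"
    and pairs: "(\<Sum>i\<in>X. \<Sum>j\<in>X. measure_pmf.prob M (A i \<inter> A j))
      \<le> (1 + d) * (\<Sum>i\<in>X. measure_pmf.prob M (A i))\<^sup>2"
  shows "measure_pmf.prob M (- (\<Union>i\<in>X. A i)) \<le> d"
proof -
  define f where "f x = (\<Sum>i\<in>X. indicat_real (A i) x)" for x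
  define \<mu> where "\<mu> = (\<Sum>i\<in>X. measure_pmf.prob M (A i))"
  have [simp]: "integrable M (indicat_real B)" for B
    by (simp add: integrable_real_indicator less_top[symmetric])
  have f2: "f x ^ 2 = (\<Sum>i\<in>X. \<Sum>j\<in>X. indicat_real (A i \<inter> A j) x)" for x
    unfolding f_def power2_eq_square sum_product by (simp add: indicator_inter_arith)
  have int: "integrable M f" and int2: "integrable M (\<lambda>x. f x ^ 2)"
    unfolding f2 by (auto simp: f_def[abs_def])
  have E: "measure_pmf.expectation M f = \<mu>"
    by (simp add: f_def[abs_def] \<mu>_def)
  have E2: "measure_pmf.expectation M (\<lambda>x. f x ^ 2) \<le> (1 + d) * \<mu>\<^sup>2"
    using pairs by (simp add: f2 \<mu>_def)
  have "measure_pmf.prob M (- (\<Union>i\<in>X. A i)) \<le> measure_pmf.prob M {x\<in>space M. \<bar>f x - \<mu>\<bar> \<ge> \<mu>}"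
    using pos by (intro measure_pmf.finite_measure_mono) (auto simp: f_def \<mu>_def)
  also have "\<dots> \<le> measure_pmf.variance M f / \<mu>\<^sup>2"
    using measure_pmf.Chebyshev_inequality[OF _ int2, of \<mu>] pos by (simp add: E \<mu>_def)
  also have "measure_pmf.variance M f = measure_pmf.expectation M (\<lambda>x. f x ^ 2) - \<mu>\<^sup>2"
    using measure_pmf.variance_eq[OF int int2] by (simp add: E)
  also have "\<dots> / \<mu>\<^sup>2 \<le> d"
    using E2 pos by (simp add: divide_simps algebra_simps \<mu>_def)
  finally show ?thesis .
qed

section \<open>Random subsets\<close>

definition random_subset :: "'a set \<Rightarrow> real \<Rightarrow> 'a set pmf" where
  "random_subset A p = map_pmf (\<lambda>f. {e \<in> A. f e}) (Pi_pmf A False (\<lambda>_. bernoulli_pmf p))"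

lemma set_pmf_random_subset: "set_pmf (random_subset A p) \<subseteq> Pow A"
  by (auto simp: random_subset_def)

text \<open>Independence on disjoint ground sets. It splits off one block at a time in
  \<open>prob_random_subset_hits\<close>, and separates early from late pairs in
  \<open>prob_two_stage_fails_le\<close>.\<close>

lemma random_subset_Un:
  assumes "finite A" "finite B" "A \<inter> B = {}"
  shows "random_subset (A \<union> B) p =
    map_pmf (\<lambda>(G, H). G \<union> H) (pair_pmf (random_subset A p) (random_subset B p))"
proof -
  have *: "{e \<in> A \<union> B. if e \<in> A then f e else g e} = {e \<in> A. f e} \<union> {e \<in> B. g e}" for f g
    using assms(3) by auto
  show ?thesis
    unfolding random_subset_def Pi_pmf_union[OF assms] map_pair[symmetric]
    by (simp only: pmf.map_comp o_def case_prod_unfold fst_conv snd_conv *)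
qed

text \<open>\<open>F\<close> may reach outside \<open>A\<close>, where it costs nothing. This fits
  the sets of pairs used later, whose pairs inside the greedy set are not among the late
  pairs.\<close>

lemma prob_random_subset_avoid:
  assumes "finite A" "0 \<le> p" "p \<le> 1"
  shows "measure_pmf.prob (random_subset A p) {G. G \<inter> F = {}} = (1 - p) ^ card (F \<inter> A)"
proof -
  define B where "B e = (if e \<in> F then {False} else UNIV)" for e
  have "(\<lambda>f. {e \<in> A. f e}) -` {G. G \<inter> F = {}} = Pi A B"
    by (auto simp: Pi_def B_def)
  moreover have "measure_pmf.prob (bernoulli_pmf p) (B e) = (if e \<in> F then 1 - p else 1)" for e
    using assms by (auto simp: B_def measure_pmf_single)
  moreover have "(\<Prod>e\<in>A. if e \<in> F then 1 - p else 1) = (1 - p) ^ card (F \<inter> A)"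
    using assms(1) by (simp add: prod.If_cases Int_commute)
  ultimately show ?thesis
    using assms(1) by (simp add: random_subset_def measure_Pi_pmf_Pi)
qed

text \<open>Disjoint blocks are hit independently. The induction removes the block
  \<open>F v\<close> from the ground set, hence \<open>A\<close> must stay arbitrary.\<close>

lemma prob_random_subset_hits:
  assumes "finite U" "finite A" "0 \<le> p" "p \<le> 1"
    and "\<And>v. v \<in> U \<Longrightarrow> F v \<subseteq> A" "disjoint_family_on F U"
  shows "measure_pmf.prob (random_subset A p) {G. \<forall>v\<in>U. G \<inter> F v \<noteq> {}}
    = (\<Prod>v\<in>U. 1 - (1 - p) ^ card (F v))"
  using assms
proof (induction U arbitrary: A rule: finite_induct)
  case empty
  then show ?case by simp
next
  case (insert v U)
  define B where "B = A - F v"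
  have disj: "F v \<inter> F u = {}" if "u \<in> U" for u
    using insert.prems(5) insert.hyps(2) that by (force simp: disjoint_family_on_def)
  have A: "A = F v \<union> B" "F v \<inter> B = {}" "finite (F v)" "finite B"
    using insert.prems(1,4) finite_subset[of "F v" A] by (auto simp: B_def)
  let ?R = "\<lambda>A. random_subset A p" and ?Q = "{G. \<forall>u\<in>U. G \<inter> F u \<noteq> {}}"
  have "measure_pmf.prob (?R A) {G. \<forall>u\<in>insert v U. G \<inter> F u \<noteq> {}}
    = measure_pmf.prob (pair_pmf (?R (F v)) (?R B))
        {z. (fst z \<union> snd z) \<inter> F v \<noteq> {} \<and> (\<forall>u\<in>U. (fst z \<union> snd z) \<inter> F u \<noteq> {})}"
    by (simp add: A(1) random_subset_Un[OF A(3,4,2)] vimage_def case_prod_unfold)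
  also have "\<dots> = measure_pmf.prob (pair_pmf (?R (F v)) (?R B)) ((- {G. G \<inter> F v = {}}) \<times> ?Q)"
  proof (rule measure_pmf.finite_measure_eq_AE)
    \<comment> \<open>The two events agree only on the support, where \<open>fst z\<close> lies in
      \<open>F v\<close> and \<open>snd z\<close> lies outside it.\<close>
    have "((fst z \<union> snd z) \<inter> F v \<noteq> {} \<and> (\<forall>u\<in>U. (fst z \<union> snd z) \<inter> F u \<noteq> {}))
        \<longleftrightarrow> z \<in> (- {G. G \<inter> F v = {}}) \<times> ?Q"
      if "z \<in> set_pmf (pair_pmf (?R (F v)) (?R B))" for z
    proof -
      have "fst z \<subseteq> F v" "snd z \<subseteq> B"
        using that subsetD[OF set_pmf_random_subset, of "fst z" "F v" p]
          subsetD[OF set_pmf_random_subset, of "snd z" B p] by (auto simp: mem_Times_iff)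
      then have "snd z \<inter> F v = {}" "\<And>u. u \<in> U \<Longrightarrow> fst z \<inter> F u = {}"
        using disj by (auto simp: B_def)
      then show ?thesis
        by (cases z) (auto simp: Int_Un_distrib2)
    qed
    then show "AE z in pair_pmf (?R (F v)) (?R B).
        (z \<in> {z. (fst z \<union> snd z) \<inter> F v \<noteq> {} \<and> (\<forall>u\<in>U. (fst z \<union> snd z) \<inter> F u \<noteq> {})})
        = (z \<in> (- {G. G \<inter> F v = {}}) \<times> ?Q)"
      by (simp add: AE_measure_pmf_iff)
  qed auto
  also have "\<dots> = (1 - measure_pmf.prob (?R (F v)) {G. G \<inter> F v = {}}) * measure_pmf.prob (?R B) ?Q"
    using measure_pmf.prob_compl[of "{G. G \<inter> F v = {}}" "?R (F v)"]
    by (simp add: prob_pair_pmf_Times Compl_eq_Diff_UNIV)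
  also have "\<dots> = (1 - (1 - p) ^ card (F v)) * (\<Prod>u\<in>U. 1 - (1 - p) ^ card (F u))"
  proof -
    have "measure_pmf.prob (?R B) ?Q = (\<Prod>u\<in>U. 1 - (1 - p) ^ card (F u))"
    proof (rule insert.IH)
      show "F u \<subseteq> B" if "u \<in> U" for u
        using that insert.prems(4) disj[OF that] by (auto simp: B_def)
      show "disjoint_family_on F U"
        using insert.prems(5) by (auto simp: disjoint_family_on_def)
    qed (use insert.prems A in auto)
    then show ?thesis
      using A insert.prems by (simp add: prob_random_subset_avoid)
  qed
  finally show ?case
    using insert.hyps by simp
qed

section \<open>Overlaps of sets of fixed size\<close>

text \<open>The quotient of the two binomial coefficients is the product of the factors (k - i) / (N
  - i) for i < j, each of which is at most k / N.\<close>

lemma binomial_diff_le: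
  assumes "j \<le> k" "k \<le> N" "N > 0"
  shows "real ((N - j) choose (k - j)) \<le> real (N choose k) * (real k / real N) ^ j"
  using assms
proof (induction j arbitrary: k N)
  case (Suc j)
  then obtain k' N' where [simp]: "k = Suc k'" "N = Suc N'"
    by (metis Suc_le_D Suc_pred)
  show ?case
  proof (cases "N' = 0")
    case False
    have "real ((N' - j) choose (k' - j)) \<le> real (N' choose k') * (real k' / real N') ^ j"
      using Suc False by (intro Suc.IH) auto
    also have "\<dots> \<le> real (N' choose k') * (real k / real N) ^ j"
      using Suc.prems False by (intro mult_left_mono power_mono) (auto simp: field_simps)
    also have "real (N' choose k') = real (N choose k) * (real k / real N)"
      using Suc_times_binomial[of k' N'] by (simp add: field_simps flip: of_nat_mult del: of_nat_Suc)
    finally show ?thesis by simp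
  qed (use Suc.prems in auto)
qed simp

lemma card_nsets_superset:
  assumes "finite U" "J \<subseteq> U" "card J \<le> k"
  shows "card {T \<in> [U]\<^bsup>k\<^esup>. J \<subseteq> T} = (card U - card J) choose (k - card J)"
proof -
  have fJ: "finite J" using assms finite_subset by blast
  have "bij_betw (\<lambda>T. T - J) {T \<in> [U]\<^bsup>k\<^esup>. J \<subseteq> T} ([U - J]\<^bsup>(k - card J)\<^esup>)"
    by (rule bij_betw_byWitness[where f' = "\<lambda>T. T \<union> J"])
      (use fJ assms in \<open>auto simp: nsets_def card_Diff_subset card_Un_disjoint subset_iff
        disjoint_iff intro!: card_Un_disjoint[THEN trans]\<close>)
  then have "card {T \<in> [U]\<^bsup>k\<^esup>. J \<subseteq> T} = card ([U - J]\<^bsup>(k - card J)\<^esup>)"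
    by (rule bij_betw_same_card)
  then show ?thesis
    using assms fJ by (simp add: card_nsets card_Diff_subset)
qed

text \<open>
  Replacing \<open>g |S \<inter> T|\<close> by the sum of \<open>g |J|\<close> over all \<open>J \<subseteq> S \<inter> T\<close> loses little and lets the
  binomial theorem evaluate the sum.
\<close>

lemma sum_overlap_le:
  fixes g :: "nat \<Rightarrow> real"
  assumes U: "finite U" "card U > 0" and S: "S \<in> [U]\<^bsup>k\<^esup>"
    and g: "\<And>j. 0 \<le> g j" "\<And>j. j \<le> k \<Longrightarrow> g j \<le> a ^ j"
  shows "(\<Sum>T\<in>[U]\<^bsup>k\<^esup>. g (card (S \<inter> T)))
    \<le> real (card U choose k) * (1 + a * real k / real (card U)) ^ k"
proof -
  have S': "S \<subseteq> U" "finite S" "card S = k"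
    using S by (auto simp: nsets_def)
  have "a \<ge> 0" if "k > 0"
    using g(1)[of 1] g(2)[of 1] that by simp
  have "(\<Sum>T\<in>[U]\<^bsup>k\<^esup>. g (card (S \<inter> T)))
      \<le> (\<Sum>T\<in>[U]\<^bsup>k\<^esup>. \<Sum>J\<in>Pow S. if J \<subseteq> T then g (card J) else 0)"
  proof (rule sum_mono)
    fix T
    show "g (card (S \<inter> T)) \<le> (\<Sum>J\<in>Pow S. if J \<subseteq> T then g (card J) else 0)"
      using member_le_sum[of "S \<inter> T" "Pow S" "\<lambda>J. if J \<subseteq> T then g (card J) else 0"] g(1) S'(2)
      by auto
  qed
  also have "\<dots> = (\<Sum>J\<in>Pow S. real (card {T \<in> [U]\<^bsup>k\<^esup>. J \<subseteq> T}) * g (card J))"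
    using U by (subst sum.swap) (simp add: sum.If_cases finite_imp_finite_nsets Int_def)
  also have "\<dots> \<le> (\<Sum>J\<in>Pow S. real (card U choose k) * (a * real k / real (card U)) ^ card J)"
  proof (rule sum_mono)
    fix J assume J: "J \<in> Pow S"
    then have le: "card J \<le> k"
      using S' card_mono[of S J] by auto
    have "card S \<le> card U"
      using S' U by (intro card_mono) auto
    then have "real (card {T \<in> [U]\<^bsup>k\<^esup>. J \<subseteq> T}) * g (card J)
        \<le> (real (card U choose k) * (real k / real (card U)) ^ card J) * a ^ card J"
      using J S' U le g binomial_diff_le[of "card J" k "card U"]
      by (subst card_nsets_superset) (auto intro!: mult_mono)
    then show "real (card {T \<in> [U]\<^bsup>k\<^esup>. J \<subseteq> T}) * g (card J)
        \<le> real (card U choose k) * (a * real k / real (card U)) ^ card J"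
      by (simp add: power_mult_distrib power_divide mult_ac)
  qed
  \<comment> \<open>\<open>prod_add\<close> expands the product of x + 1 over the elements of
    \<open>S\<close> into the sum of the powers x ^ card J over all subsets \<open>J\<close> of
    \<open>S\<close>.\<close>
  also have "\<dots> = real (card U choose k) * (1 + a * real k / real (card U)) ^ k"
    using prod_add[OF S'(2), of "\<lambda>_. a * real k / real (card U)" "\<lambda>_. 1"] S'
    by (simp add: sum_distrib_left add.commute)
  finally show ?thesis .
qed

section \<open>Dominating sets and independent extensions\<close>

lemma image_Int_nonempty_iff: "B \<inter> f ` A \<noteq> {} \<longleftrightarrow> (\<exists>x\<in>A. f x \<in> B)"
  by auto

text \<open>Union bound over at most k * card V ^ k sets \<open>S\<close>. For a fixed
  \<open>S\<close>, each of the at least card V - k vertices outside must have a neighbour in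
  \<open>S\<close>, which has probability at most 1 - (1 - p) ^ k, independently for different
  vertices.\<close>

lemma prob_small_dominating_set_le:
  assumes "finite V" "finite A" "[V]\<^bsup>2\<^esup> \<subseteq> A" "0 \<le> p" "p \<le> 1" "V \<noteq> {}"
  shows "measure_pmf.prob (random_subset A p)
      {G. \<exists>S\<subseteq>V. card S < k \<and> (\<forall>v\<in>V - S. \<exists>u\<in>S. {u, v} \<in> G)}
    \<le> real k * real (card V) ^ k * (1 - (1 - p) ^ k) ^ (card V - k)"
proof -
  define \<S> where "\<S> = {S. S \<subseteq> V \<and> card S < k}"
  define dom where "dom S G \<longleftrightarrow> (\<forall>v\<in>V - S. \<exists>u\<in>S. {u, v} \<in> G)" for S G
  define D where "D S = {G. dom S G}" for S
  have fin: "finite \<S>"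
    using assms by (auto simp: \<S>_def)
  have D: "measure_pmf.prob (random_subset A p) (D S) \<le> (1 - (1 - p) ^ k) ^ (card V - k)"
    if "S \<in> \<S>" for S
  proof -
    have S: "S \<subseteq> V" "finite S" "card S < k"
      using that assms finite_subset by (auto simp: \<S>_def)
    have "card ((\<lambda>u. {u, v}) ` S) = card S" for v
      by (intro card_image) (auto simp: inj_on_def doubleton_eq_iff)
    \<comment> \<open>A pair shared by the stars of two distinct outside vertices would put one of
      these vertices into \<open>S\<close>.\<close>
    moreover have "disjoint_family_on (\<lambda>v. (\<lambda>u. {u, v}) ` S) (V - S)"
      by (auto simp: disjoint_family_on_def doubleton_eq_iff)
    moreover have "(\<lambda>u. {u, v}) ` S \<subseteq> A" if "v \<in> V - S" for v
      using that S assms(3) by (intro order_trans[OF _ assms(3)]) auto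
    ultimately have "measure_pmf.prob (random_subset A p) (D S) = (1 - (1 - p) ^ card S) ^ card (V - S)"
      using prob_random_subset_hits[of "V - S" A p "\<lambda>v. (\<lambda>u. {u, v}) ` S"] assms
      unfolding D_def dom_def image_Int_nonempty_iff by simp
    also have "\<dots> \<le> (1 - (1 - p) ^ k) ^ card (V - S)"
      using S assms by (intro power_mono) (auto intro!: power_decreasing power_le_one)
    also have "\<dots> \<le> (1 - (1 - p) ^ k) ^ (card V - k)"
      using S assms by (intro power_decreasing) (auto simp: card_Diff_subset power_le_one)
    finally show ?thesis .
  qed
  have "card \<S> = (\<Sum>j<k. card ([V]\<^bsup>j\<^esup>))"
  proof -
    have "\<S> = (\<Union>j<k. [V]\<^bsup>j\<^esup>)"
      using assms finite_subset by (auto simp: \<S>_def nsets_def)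
    then show ?thesis
      using assms by (auto intro!: card_UN_disjoint finite_imp_finite_nsets simp: nsets_def)
  qed
  also have "\<dots> \<le> (\<Sum>j<k. card V ^ k)"
  proof (rule sum_mono)
    fix j assume "j \<in> {..<k}"
    then have "card V ^ j \<le> card V ^ k"
      using assms by (intro power_increasing) (auto simp: Suc_le_eq card_gt_0_iff)
    then show "card ([V]\<^bsup>j\<^esup>) \<le> card V ^ k"
      using binomial_le_pow[of j "card V"] by (cases "j \<le> card V") (auto simp: binomial_eq_0)
  qed
  finally have "real (card \<S>) \<le> real k * real (card V) ^ k"
    by (simp flip: of_nat_power of_nat_mult)
  have "{G. \<exists>S\<subseteq>V. card S < k \<and> (\<forall>v\<in>V - S. \<exists>u\<in>S. {u, v} \<in> G)} = (\<Union>S\<in>\<S>. D S)"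
    unfolding dom_def[symmetric] by (auto simp: \<S>_def D_def)
  then have "measure_pmf.prob (random_subset A p)
      {G. \<exists>S\<subseteq>V. card S < k \<and> (\<forall>v\<in>V - S. \<exists>u\<in>S. {u, v} \<in> G)}
    = measure_pmf.prob (random_subset A p) (\<Union>S\<in>\<S>. D S)"
    by (rule arg_cong)
  also have "\<dots> \<le> (\<Sum>S\<in>\<S>. measure_pmf.prob (random_subset A p) (D S))"
    using fin by (intro measure_UNION_le) simp_all
  also have "\<dots> \<le> real (card \<S>) * (1 - (1 - p) ^ k) ^ (card V - k)"
    using sum_bounded_above[of \<S>, OF D] by simp
  also have "\<dots> \<le> real k * real (card V) ^ k * (1 - (1 - p) ^ k) ^ (card V - k)"
    using \<open>real (card \<S>) \<le> _\<close> assms by (intro mult_right_mono) (auto simp: power_le_one)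
  finally show ?thesis .
qed

lemma nsets_Int: "[A \<inter> B]\<^bsup>k\<^esup> = [A]\<^bsup>k\<^esup> \<inter> [B]\<^bsup>k\<^esup>"
  by (auto simp: nsets_def)

lemma card_nsets_2_Un_diff:
  assumes "finite I" "finite T" "I \<inter> T = {}"
  shows "card ([I \<union> T]\<^bsup>2\<^esup> - [I]\<^bsup>2\<^esup>) = (card I + card T choose 2) - (card I choose 2)"
  using assms by (simp add: card_Diff_subset finite_imp_finite_nsets nsets_mono card_Un_disjoint)

lemma real_choose_two: "real (n choose 2) = real n * (real n - 1) / 2"
  by (induction n) (simp_all add: numeral_2_eq_2 field_simps)

lemma choose_two_add: "(i + j choose 2) = (i choose 2) + i * j + (j choose 2)"
  by (induction j) (simp_all add: numeral_2_eq_2)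

text \<open>Second moment method for the events \<open>E T\<close>. The sum of the probabilities of
  \<open>E S \<inter> E T\<close> exceeds the squared sum of the single probabilities by the average
  of (1 / q) ^ h (card (S \<inter> T)) as a factor, and \<open>sum_overlap_le\<close> bounds this
  average.\<close>

lemma prob_no_independent_extension_le:
  fixes p :: real
  assumes fin: "finite I" "finite U" "finite A" and U: "I \<inter> U = {}" "card U > 0" "k \<le> card U"
    and A: "[I]\<^bsup>2\<^esup> \<inter> A = {}" "[I \<union> U]\<^bsup>2\<^esup> - [I]\<^bsup>2\<^esup> \<subseteq> A" and p: "0 \<le> p" "p < 1"
  shows "measure_pmf.prob (random_subset A p) {H. \<not> (\<exists>T\<in>[U]\<^bsup>k\<^esup>. [I \<union> T]\<^bsup>2\<^esup> \<inter> H = {})}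
    \<le> (1 + (1 / (1 - p)) powr (real (card I) + real k / 2) * real k / real (card U)) ^ k - 1"
proof -
  define q where "q = 1 - p"
  have q: "0 < q" "q \<le> 1"
    using p by (auto simp: q_def)
  \<comment> \<open>\<open>h j\<close> counts the pairs that j new vertices add to those inside
    \<open>I\<close>: the cross pairs and the pairs among the new vertices.\<close>
  define h where "h j = card I * j + (j choose 2)" for j
  \<comment> \<open>For 0 < j <= k, the quotient h j / j = card I + (j - 1) / 2 is at most card I +
    k / 2. This turns the quadratic exponent into a geometric bound, as
    \<open>sum_overlap_le\<close> requires.\<close>
  define a where "a = (1 / q) powr (real (card I) + real k / 2)"
  define E where "E T = {H. H \<inter> [I \<union> T]\<^bsup>2\<^esup> = {}}" for T
  define c where "c = real (card U choose k)"
  have c: "c > 0"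
    using U by (simp add: c_def)
  have T: "finite T" "card T = k" "I \<inter> T = {}" "[I \<union> T]\<^bsup>2\<^esup> \<inter> A = [I \<union> T]\<^bsup>2\<^esup> - [I]\<^bsup>2\<^esup>"
    if "T \<in> [U]\<^bsup>k\<^esup>" for T
  proof -
    have "T \<subseteq> U"
      using that by (auto simp: nsets_def)
    then have "[I \<union> T]\<^bsup>2\<^esup> - [I]\<^bsup>2\<^esup> \<subseteq> A"
      using A(2) nsets_mono[of "I \<union> T" "I \<union> U" 2] by blast
    then show "[I \<union> T]\<^bsup>2\<^esup> \<inter> A = [I \<union> T]\<^bsup>2\<^esup> - [I]\<^bsup>2\<^esup>"
      using A(1) by auto
  qed (use that U(1) in \<open>auto simp: nsets_def\<close>)
  have cd: "card ([I \<union> T]\<^bsup>2\<^esup> - [I]\<^bsup>2\<^esup>) = h (card T)" if "finite T" "I \<inter> T = {}" for T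
    using card_nsets_2_Un_diff[OF fin(1) that] by (simp add: choose_two_add h_def)
  have single: "measure_pmf.prob (random_subset A p) (E T) = q ^ h k" if "T \<in> [U]\<^bsup>k\<^esup>" for T
    unfolding E_def using prob_random_subset_avoid[OF fin(3), of p] p T[OF that] cd[of T]
    by (simp add: q_def)
  have pair: "measure_pmf.prob (random_subset A p) (E S \<inter> E T)
      = (q ^ h k)\<^sup>2 * (1 / q) ^ h (card (S \<inter> T))" if S: "S \<in> [U]\<^bsup>k\<^esup>" and T': "T \<in> [U]\<^bsup>k\<^esup>" for S T
  proof -
    let ?X = "[I \<union> S]\<^bsup>2\<^esup> - [I]\<^bsup>2\<^esup>" and ?Y = "[I \<union> T]\<^bsup>2\<^esup> - [I]\<^bsup>2\<^esup>"
    have "?X \<inter> ?Y = [I \<union> (S \<inter> T)]\<^bsup>2\<^esup> - [I]\<^bsup>2\<^esup>"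
      by (auto simp: Un_Int_distrib nsets_Int)
    moreover have "I \<inter> (S \<inter> T) = {}"
      using T(3)[OF S] by auto
    ultimately have "card (?X \<inter> ?Y) = h (card (S \<inter> T))"
      using T(1)[OF S] by (simp add: cd)
    \<comment> \<open>By inclusion-exclusion, \<open>E S \<inter> E T\<close> forbids exactly 2 * h
      k - h (card (S \<inter> T)) pairs of \<open>A\<close>.\<close>
    moreover have "card ?X + card ?Y = card (?X \<union> ?Y) + card (?X \<inter> ?Y)"
      using T(1)[OF S] T(1)[OF T'] fin(1)
      by (intro card_Un_Int) (auto intro!: finite_imp_finite_nsets)
    ultimately have "2 * h k = card (?X \<union> ?Y) + h (card (S \<inter> T))"
      using T[OF S] T[OF T'] by (simp add: cd)
    then have "(q ^ h k)\<^sup>2 = q ^ card (?X \<union> ?Y) * q ^ h (card (S \<inter> T))"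
      by (simp flip: power_add power_mult add: mult.commute[of "h k"])
    moreover have "E S \<inter> E T = {H. H \<inter> ([I \<union> S]\<^bsup>2\<^esup> \<union> [I \<union> T]\<^bsup>2\<^esup>) = {}}"
      by (auto simp: E_def)
    moreover have "([I \<union> S]\<^bsup>2\<^esup> \<union> [I \<union> T]\<^bsup>2\<^esup>) \<inter> A = ?X \<union> ?Y"
      using T(4)[OF S] T(4)[OF T'] by blast
    ultimately show ?thesis
      using prob_random_subset_avoid[OF fin(3), of p "[I \<union> S]\<^bsup>2\<^esup> \<union> [I \<union> T]\<^bsup>2\<^esup>"] p q
      by (simp add: q_def[symmetric] power_divide)
  qed
  have g: "(1 / q) ^ h j \<le> a ^ j" if "j \<le> k" for j
  proof -
    have "real (h j) = real (card I) * real j + real j * (real j - 1) / 2"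
      by (simp add: h_def real_choose_two)
    also have "\<dots> = (real (card I) + (real j - 1) / 2) * real j"
      by (simp add: algebra_simps)
    also have "\<dots> \<le> (real (card I) + real k / 2) * real j"
      using that by (intro mult_right_mono) auto
    finally have "(1 / q) powr real (h j) \<le> (1 / q) powr ((real (card I) + real k / 2) * real j)"
      using q by (intro powr_mono) auto
    then show ?thesis
      using q by (simp add: a_def powr_realpow powr_powr[symmetric])
  qed
  have "measure_pmf.prob (random_subset A p) (- (\<Union>T\<in>[U]\<^bsup>k\<^esup>. E T)) \<le> (1 + a * real k / real (card U)) ^ k - 1"
  proof (rule second_moment_union)
    have sum1: "(\<Sum>T\<in>[U]\<^bsup>k\<^esup>. measure_pmf.prob (random_subset A p) (E T)) = c * q ^ h k"
      using single by (simp add: c_def)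
    then show "0 < (\<Sum>T\<in>[U]\<^bsup>k\<^esup>. measure_pmf.prob (random_subset A p) (E T))"
      using c q by simp
    have "(\<Sum>S\<in>[U]\<^bsup>k\<^esup>. \<Sum>T\<in>[U]\<^bsup>k\<^esup>. measure_pmf.prob (random_subset A p) (E S \<inter> E T))
        = (\<Sum>S\<in>[U]\<^bsup>k\<^esup>. (q ^ h k)\<^sup>2 * (\<Sum>T\<in>[U]\<^bsup>k\<^esup>. (1 / q) ^ h (card (S \<inter> T))))"
      by (simp add: pair sum_distrib_left)
    also have "\<dots> \<le> (\<Sum>S\<in>[U]\<^bsup>k\<^esup>. (q ^ h k)\<^sup>2 * (c * (1 + a * real k / real (card U)) ^ k))"
      using q g U(2) fin(2) unfolding c_def
      by (intro sum_mono mult_left_mono sum_overlap_le) auto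
    also have "\<dots> = c * ((q ^ h k)\<^sup>2 * (c * (1 + a * real k / real (card U)) ^ k))"
      by (simp only: sum_constant card_nsets c_def)
    also have "\<dots> = (1 + ((1 + a * real k / real (card U)) ^ k - 1)) * (c * q ^ h k)\<^sup>2"
      by (simp add: power_mult_distrib power2_eq_square)
    finally show "(\<Sum>S\<in>[U]\<^bsup>k\<^esup>. \<Sum>T\<in>[U]\<^bsup>k\<^esup>. measure_pmf.prob (random_subset A p) (E S \<inter> E T))
      \<le> (1 + ((1 + a * real k / real (card U)) ^ k - 1))
        * (\<Sum>T\<in>[U]\<^bsup>k\<^esup>. measure_pmf.prob (random_subset A p) (E T))\<^sup>2"
      unfolding sum1 .
  qed (use fin in \<open>auto intro!: finite_imp_finite_nsets\<close>)
  moreover have "- (\<Union>T\<in>[U]\<^bsup>k\<^esup>. E T) = {H. \<not> (\<exists>T\<in>[U]\<^bsup>k\<^esup>. [I \<union> T]\<^bsup>2\<^esup> \<inter> H = {})}"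
    by (auto simp: E_def)
  ultimately show ?thesis
    by (simp add: a_def q_def)
qed

section \<open>The two-stage algorithm\<close>

text \<open>Defined on the graph itself rather than on the information of a run: the estimates
  concern this function only, and \<open>run_two_stage\<close> shows that the strategy computes
  it.\<close>

primrec greedy :: "nat \<Rightarrow> edge set \<Rightarrow> nat \<Rightarrow> nat set" where
  "greedy k G 0 = {}"
| "greedy k G (Suc t) =
     (if card (greedy k G t) < k \<and> (\<forall>u\<in>greedy k G t. {u, Suc t} \<notin> G)
      then insert (Suc t) (greedy k G t) else greedy k G t)"

lemma greedy_subset: "greedy k G t \<subseteq> {1..t}"
  by (induction t) auto

lemma finite_greedy [simp]: "finite (greedy k G t)"
  by (rule finite_subset[OF greedy_subset]) simp

lemma greedy_mono: "s \<le> t \<Longrightarrow> greedy k G s \<subseteq> greedy k G t"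
  by (induction t) (auto simp: le_Suc_eq split: if_splits)

lemma card_greedy_le: "card (greedy k G t) \<le> k"
  by (induction t) (auto simp: card_insert_if)

lemma nsets_2_insert: "[insert v I]\<^bsup>2\<^esup> = [I]\<^bsup>2\<^esup> \<union> (\<lambda>u. {u, v}) ` (I - {v})"
  by (auto simp: nsets_2_eq)

lemma greedy_independent: "[greedy k G t]\<^bsup>2\<^esup> \<inter> G = {}"
  by (induction t) (auto simp: nsets_2_insert nsets_empty_iff)

text \<open>This makes the greedy set a function of the early pairs alone, hence independent of the
  late pairs.\<close>

lemma greedy_cong:
  assumes "G \<inter> [{1..t}]\<^bsup>2\<^esup> = H \<inter> [{1..t}]\<^bsup>2\<^esup>"
  shows "greedy k G t = greedy k H t"
  using assms
proof (induction t)
  case (Suc t)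
  have "greedy k G t = greedy k H t"
    using Suc.prems nsets_mono[of "{1..t}" "{1..Suc t}" 2] by (intro Suc.IH) auto
  moreover have "{u, Suc t} \<in> G \<longleftrightarrow> {u, Suc t} \<in> H" if "u \<in> greedy k H t" for u
  proof -
    have "{u, Suc t} \<in> [{1..Suc t}]\<^bsup>2\<^esup>"
      using greedy_subset that by fastforce
    then show ?thesis
      using Suc.prems by blast
  qed
  ultimately show ?case by auto
qed simp

text \<open>The sets only grow, so a final size below \<open>k\<close> means that the cap never took
  effect. Every rejected vertex then had a neighbour among those already accepted.\<close>

lemma greedy_dominating:
  assumes "card (greedy k G t) < k" "v \<in> {1..t} - greedy k G t"
  shows "\<exists>u\<in>greedy k G t. {u, v} \<in> G"
  using assms
proof (induction t)
  case (Suc t)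
  have sub: "greedy k G t \<subseteq> greedy k G (Suc t)"
    by auto
  then have "card (greedy k G t) < k"
    using Suc.prems(1) card_mono[OF finite_greedy sub] by linarith
  then show ?case
  proof (cases "v = Suc t")
    case True
    then show ?thesis
      using Suc.prems(2) \<open>card (greedy k G t) < k\<close> by (simp split: if_splits) blast
  next
    case False
    then have "v \<in> {1..t} - greedy k G t"
      using Suc.prems(2) sub by auto
    then show ?thesis
      using Suc.IH \<open>card (greedy k G t) < k\<close> sub by blast
  qed
qed simp

text \<open>The choice depends on \<open>I\<close> and \<open>H\<close> only, so every later round
  recomputes the same set. The default is empty, which adds no queried pair to the output when the
  greedy stage falls short or no extension exists.\<close>

definition extension :: "nat \<Rightarrow> nat \<Rightarrow> nat set \<Rightarrow> nat set \<Rightarrow> edge set \<Rightarrow> nat set" where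
  "extension k\<^sub>1 k\<^sub>2 U I H =
     (if card I = k\<^sub>1 \<and> (\<exists>T\<in>[U]\<^bsup>k\<^sub>2\<^esup>. [I \<union> T]\<^bsup>2\<^esup> \<inter> H = {})
      then SOME T. T \<in> [U]\<^bsup>k\<^sub>2\<^esup> \<and> [I \<union> T]\<^bsup>2\<^esup> \<inter> H = {} else {})"

lemma extension_cases:
  obtains "extension k\<^sub>1 k\<^sub>2 U I H = {}"
      "\<not> (card I = k\<^sub>1 \<and> (\<exists>T\<in>[U]\<^bsup>k\<^sub>2\<^esup>. [I \<union> T]\<^bsup>2\<^esup> \<inter> H = {}))"
  | "card I = k\<^sub>1" "extension k\<^sub>1 k\<^sub>2 U I H \<in> [U]\<^bsup>k\<^sub>2\<^esup>" "[I \<union> extension k\<^sub>1 k\<^sub>2 U I H]\<^bsup>2\<^esup> \<inter> H = {}"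
proof (cases "card I = k\<^sub>1 \<and> (\<exists>T\<in>[U]\<^bsup>k\<^sub>2\<^esup>. [I \<union> T]\<^bsup>2\<^esup> \<inter> H = {})")
  case True
  then have "\<exists>T. T \<in> [U]\<^bsup>k\<^sub>2\<^esup> \<and> [I \<union> T]\<^bsup>2\<^esup> \<inter> H = {}" by blast
  from someI_ex[OF this] True show ?thesis
    by (intro that(2)) (simp_all add: extension_def)
next
  case False
  then show ?thesis
    by (intro that(1)) (simp_all only: extension_def if_False not_False_eq_True)
qed

lemma extension_subset: "extension k\<^sub>1 k\<^sub>2 U I H \<subseteq> U"
  by (rule extension_cases[of k\<^sub>1 k\<^sub>2 U I H]) (auto simp: nsets_def)

definition late_pairs :: "nat \<Rightarrow> nat \<Rightarrow> edge set" where
  "late_pairs n m = [{1..n}]\<^bsup>2\<^esup> - [{1..m}]\<^bsup>2\<^esup>"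

text \<open>Vertices come in increasing order, and round \<open>m\<close> reveals all late pairs at
  once. After that the extension can be recomputed from the information: the accepted vertices up to
  \<open>m\<close> are the greedy set, and the status of every late pair is known.\<close>

definition two_stage :: "nat \<Rightarrow> nat \<Rightarrow> nat \<Rightarrow> nat \<Rightarrow> strategy" where
  "two_stage n m k\<^sub>1 k\<^sub>2 =
     \<lparr>choose_vertex = (\<lambda>s. Suc (length (selected s))),
      choose_pairs = (\<lambda>s. if length (selected s) = m then late_pairs n m else {}),
      accepts = (\<lambda>s. let v = hd (selected s) in
        if v \<le> m then card (accepted s) < k\<^sub>1 \<and> (\<forall>u\<in>accepted s. status s {u, v} = Some False)
        else v \<in> extension k\<^sub>1 k\<^sub>2 {m<..n} (accepted s \<inter> {..m})
                   {e \<in> late_pairs n m. status s e = Some True})\<rparr>"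

abbreviation late_set :: "nat \<Rightarrow> nat \<Rightarrow> nat \<Rightarrow> nat \<Rightarrow> edge set \<Rightarrow> nat set" where
  "late_set n m k\<^sub>1 k\<^sub>2 G \<equiv> extension k\<^sub>1 k\<^sub>2 {m<..n} (greedy k\<^sub>1 G m) (late_pairs n m \<inter> G)"

text \<open>A closed form of the whole state, from which legality, output and queries are read off.
  For m = 0 it would fail at t = 0, where the late pairs would count as revealed.\<close>

lemma run_two_stage:
  assumes "0 < m"
  shows "run (two_stage n m k\<^sub>1 k\<^sub>2) G t =
    \<lparr>selected = rev [1..<Suc t],
     accepted = greedy k\<^sub>1 G (min t m) \<union> (late_set n m k\<^sub>1 k\<^sub>2 G \<inter> {m<..t}),
     queried = map (\<lambda>i. if i = m then late_pairs n m else {}) (rev [1..<Suc t]),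
     status = (\<lambda>e. if e \<in> [{1..t}]\<^bsup>2\<^esup> \<or> m \<le> t \<and> e \<in> late_pairs n m then Some (e \<in> G) else None)\<rparr>"
proof (induction t)
  case 0
  have "[{1..0::nat}]\<^bsup>2\<^esup> = {}"
    by (simp add: nsets_def)
  then show ?case
    using assms by (simp add: initial_info_def)
next
  case (Suc t)
  define a where "a = two_stage n m k\<^sub>1 k\<^sub>2"
  define L where "L = late_set n m k\<^sub>1 k\<^sub>2 G"
  define A where "A = greedy k\<^sub>1 G (min t m) \<union> (L \<inter> {m<..t})"
  define Q where "Q = map (\<lambda>i. if i = m then late_pairs n m else {}) (rev [1..<Suc t])"
  define st where "st t e = (if e \<in> [{1..t}]\<^bsup>2\<^esup> \<or> m \<le> t \<and> e \<in> late_pairs n m then Some (e \<in> G) else None)"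
    for t e
  define s where "s = \<lparr>selected = Suc t # rev [1..<Suc t], accepted = A,
    queried = (if Suc t = m then late_pairs n m else {}) # Q, status = st (Suc t)\<rparr>"
  \<comment> \<open>The pairs added here are those revealed by the first step of the round.\<close>
  have pairs: "[{1..Suc t}]\<^bsup>2\<^esup> = [{1..t}]\<^bsup>2\<^esup> \<union> {{Suc t, u} |u. u \<in> {1..t}}"
  proof -
    have "{1..Suc t} = insert (Suc t) {1..t}" by auto
    then show ?thesis
      by (auto simp: nsets_2_insert insert_commute)
  qed
  have IH: "run a G t = \<lparr>selected = rev [1..<Suc t], accepted = A, queried = Q, status = st t\<rparr>"
    using Suc.IH by (simp add: a_def A_def L_def Q_def st_def[abs_def])
  have "step2 a G (step1 a G (run a G t)) = s"
    unfolding IH s_def step1_def step2_def Let_def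
    by (auto simp: a_def two_stage_def reveal_def fun_eq_iff st_def pairs[unfolded One_nat_def] le_Suc_eq)
  then have run: "run a G (Suc t) = step3 a s"
    by simp
  have acc: "(if accepts a s then insert (Suc t) A else A)
    = greedy k\<^sub>1 G (min (Suc t) m) \<union> (L \<inter> {m<..Suc t})"
  proof (cases "Suc t \<le> m")
    case True
    then have "A = greedy k\<^sub>1 G t"
      by (auto simp: A_def)
    moreover have "st (Suc t) {u, Suc t} = Some ({u, Suc t} \<in> G)" if "u \<in> greedy k\<^sub>1 G t" for u
      using that greedy_subset[of k\<^sub>1 G t] by (auto simp: st_def)
    ultimately show ?thesis
      using True by (auto simp: a_def two_stage_def s_def min_def)
  next
    case False
    have "A \<inter> {..m} = greedy k\<^sub>1 G m"
      using False greedy_subset[of k\<^sub>1 G m] by (auto simp: A_def)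
    moreover have "{e \<in> late_pairs n m. st (Suc t) e = Some True} = late_pairs n m \<inter> G"
      using False by (auto simp: st_def)
    ultimately have "accepts a s \<longleftrightarrow> Suc t \<in> L"
      using False by (simp add: a_def two_stage_def s_def L_def)
    then show ?thesis
      using False by (auto simp: A_def le_Suc_eq)
  qed
  have "run a G (Suc t) = s\<lparr>accepted := if accepts a s then insert (Suc t) A else A\<rparr>"
    unfolding run step3_def by (simp add: s_def)
  then show ?case
    unfolding acc by (simp add: s_def a_def L_def Q_def st_def[abs_def])
qed

section \<open>Legality and query bound of the two-stage strategy\<close>

lemma
  assumes "0 < m"
  shows V_set_two_stage: "V_set (two_stage n m k\<^sub>1 k\<^sub>2) G t = {1..t}"
    and A_set_two_stage: "A_set (two_stage n m k\<^sub>1 k\<^sub>2) G t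
      = greedy k\<^sub>1 G (min t m) \<union> (late_set n m k\<^sub>1 k\<^sub>2 G \<inter> {m<..t})"
    and E_set_two_stage: "E_set (two_stage n m k\<^sub>1 k\<^sub>2) G t \<subseteq> late_pairs n m"
  unfolding V_set_def A_set_def E_set_def run_two_stage[OF assms]
  by (simp_all del: upt_Suc add: atLeastLessThanSuc_atLeastAtMost UN_subset_iff)

lemma final_set_two_stage:
  assumes "0 < m" "m \<le> n"
  shows "final_set n (two_stage n m k\<^sub>1 k\<^sub>2) G = greedy k\<^sub>1 G m \<union> late_set n m k\<^sub>1 k\<^sub>2 G"
  using assms extension_subset[of k\<^sub>1 k\<^sub>2 "{m<..n}"]
  by (simp add: final_set_def A_set_two_stage min_absorb2 inf_absorb1)

lemma greedy_Int_extension: "greedy k\<^sub>1 G m \<inter> extension k\<^sub>1 k\<^sub>2 {m<..n} I H = {}"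
proof -
  have "greedy k\<^sub>1 G m \<inter> extension k\<^sub>1 k\<^sub>2 {m<..n} I H \<subseteq> {1..m} \<inter> {m<..n}"
    by (intro Int_mono greedy_subset extension_subset)
  also have "\<dots> = {}" by auto
  finally show ?thesis by simp
qed

text \<open>Late pairs are excluded by the choice of the extension. The other pairs lie inside
  \<open>{1..m}\<close>, hence inside the greedy set, because the extension uses only vertices
  beyond \<open>m\<close>.\<close>

lemma two_stage_independent:
  assumes "G \<in> graphs n"
  shows "[greedy k\<^sub>1 G m \<union> late_set n m k\<^sub>1 k\<^sub>2 G]\<^bsup>2\<^esup> \<inter> G = {}"
proof -
  let ?I = "greedy k\<^sub>1 G m" and ?T = "late_set n m k\<^sub>1 k\<^sub>2 G"
  have "[?I \<union> ?T]\<^bsup>2\<^esup> \<inter> (late_pairs n m \<inter> G) = {}"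
    by (rule extension_cases[of k\<^sub>1 k\<^sub>2 "{m<..n}" ?I "late_pairs n m \<inter> G"])
      (use greedy_independent[of k\<^sub>1 G m] in auto)
  moreover have "[?I \<union> ?T]\<^bsup>2\<^esup> \<inter> [{1..m}]\<^bsup>2\<^esup> \<subseteq> [?I]\<^bsup>2\<^esup>"
    using extension_subset[of k\<^sub>1 k\<^sub>2 "{m<..n}" ?I "late_pairs n m \<inter> G"]
    by (fastforce simp: nsets_def)
  moreover have "G \<subseteq> late_pairs n m \<union> [{1..m}]\<^bsup>2\<^esup>"
    using assms by (auto simp: graphs_def late_pairs_def)
  ultimately show ?thesis
    using greedy_independent[of k\<^sub>1 G m] by blast
qed

lemma online_algorithm_two_stage:
  assumes "0 < m" "m \<le> n"
  shows "online_algorithm n (two_stage n m k\<^sub>1 k\<^sub>2)"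
  unfolding online_algorithm_def
proof (intro ballI allI impI conjI)
  fix G t assume G: "G \<in> graphs n" and t: "t < n"
  let ?a = "two_stage n m k\<^sub>1 k\<^sub>2"
  show "choose_vertex ?a (run ?a G t) \<in> {1..n} - V_set ?a G t"
    using t unfolding V_set_two_stage[OF assms(1)] run_two_stage[OF assms(1)]
    by (simp add: two_stage_def)
  show "choose_pairs ?a (step1 ?a G (run ?a G t)) \<subseteq> [{1..n}]\<^bsup>2\<^esup>"
    by (simp add: two_stage_def late_pairs_def)
  \<comment> \<open>Accepted vertices are never dropped, so independence of the final set covers
    every round.\<close>
  have "A_set ?a G (Suc t) \<subseteq> greedy k\<^sub>1 G m \<union> late_set n m k\<^sub>1 k\<^sub>2 G" (is "_ \<subseteq> ?F")
    using greedy_mono[of "min (Suc t) m" m k\<^sub>1 G] by (auto simp: A_set_two_stage[OF assms(1)])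
  moreover have "?F \<subseteq> {1..n}"
    using greedy_subset[of k\<^sub>1 G m] assms extension_subset[of k\<^sub>1 k\<^sub>2 "{m<..n}" "greedy k\<^sub>1 G m"] by fastforce
  ultimately show "indep_set n G (A_set ?a G (Suc t))"
    using two_stage_independent[OF G, of k\<^sub>1 m k\<^sub>2] nsets_mono[of "A_set ?a G (Suc t)" ?F 2]
    by (auto simp: indep_set_def)
qed


text \<open>Only late pairs are queried and none lies inside the greedy set, so every counted pair
  meets the extension. If the extension is empty, nothing is counted.\<close>

lemma restricted_two_stage:
  assumes "0 < m" "m \<le> n"
    and "real ((k\<^sub>1 + k\<^sub>2 choose 2) - (k\<^sub>1 choose 2)) \<le> c * (log (1 / (1 - p)) (real n * p))\<^sup>2"
    and "0 \<le> c"
  shows "restricted c n p (two_stage n m k\<^sub>1 k\<^sub>2)"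
  unfolding restricted_def
proof
  fix G assume "G \<in> graphs n"
  let ?a = "two_stage n m k\<^sub>1 k\<^sub>2" and ?I = "greedy k\<^sub>1 G m" and ?T = "late_set n m k\<^sub>1 k\<^sub>2 G"
  have "[?I]\<^bsup>2\<^esup> \<inter> late_pairs n m = {}"
    using nsets_mono[OF greedy_subset[of k\<^sub>1 G m], of 2] by (auto simp: late_pairs_def)
  then have sub: "E_set ?a G n \<inter> [final_set n ?a G]\<^bsup>2\<^esup> \<subseteq> [?I \<union> ?T]\<^bsup>2\<^esup> - [?I]\<^bsup>2\<^esup>"
    using E_set_two_stage[OF assms(1), of n k\<^sub>1 k\<^sub>2 G n]
    by (auto simp: final_set_two_stage[OF assms(1,2)])
  have T: "finite ?T" "?I \<inter> ?T = {}"
    by (rule finite_subset[OF extension_subset], simp, rule greedy_Int_extension)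
  have "card ([?I \<union> ?T]\<^bsup>2\<^esup> - [?I]\<^bsup>2\<^esup>) \<le> (k\<^sub>1 + k\<^sub>2 choose 2) - (k\<^sub>1 choose 2)"
  proof (rule extension_cases[of k\<^sub>1 k\<^sub>2 "{m<..n}" ?I "late_pairs n m \<inter> G"])
    assume "card ?I = k\<^sub>1" "?T \<in> [{m<..n}]\<^bsup>k\<^sub>2\<^esup>"
    then show ?thesis
      using card_nsets_2_Un_diff[OF _ T] by (simp add: nsets_def)
  qed simp
  moreover have "card (E_set ?a G n \<inter> [final_set n ?a G]\<^bsup>2\<^esup>) \<le> card ([?I \<union> ?T]\<^bsup>2\<^esup> - [?I]\<^bsup>2\<^esup>)"
    using T by (intro card_mono sub) (auto intro!: finite_imp_finite_nsets)
  ultimately show "real (card (E_set ?a G n \<inter> [final_set n ?a G]\<^bsup>2\<^esup>))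
      \<le> c * (log (1 / (1 - p)) (real n * p))\<^sup>2"
    using assms(3) by linarith
qed

section \<open>Failure probability for fixed parameters\<close>

lemma random_graph_eq: "random_graph n p = random_subset ([{1..n}]\<^bsup>2\<^esup>) p"
  by (simp add: random_graph_def random_subset_def)

lemma card_final_set_two_stage:
  assumes "0 < m" "m \<le> n" "card (greedy k\<^sub>1 G m) = k\<^sub>1"
    and "\<exists>T\<in>[{m<..n}]\<^bsup>k\<^sub>2\<^esup>. [greedy k\<^sub>1 G m \<union> T]\<^bsup>2\<^esup> \<inter> (late_pairs n m \<inter> G) = {}"
  shows "card (final_set n (two_stage n m k\<^sub>1 k\<^sub>2) G) = k\<^sub>1 + k\<^sub>2"
proof (rule extension_cases[of k\<^sub>1 k\<^sub>2 "{m<..n}" "greedy k\<^sub>1 G m" "late_pairs n m \<inter> G"])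
  assume T: "late_set n m k\<^sub>1 k\<^sub>2 G \<in> [{m<..n}]\<^bsup>k\<^sub>2\<^esup>"
  then show ?thesis
    unfolding final_set_two_stage[OF assms(1,2)]
    using assms(3) by (subst card_Un_disjoint) (simp_all add: greedy_Int_extension nsets_def)
qed (use assms in auto)

text \<open>One summand for each stage. A greedy set that is too small dominates
  \<open>{1..m}\<close>; otherwise the extension must be missing, and its bound holds conditionally
  on the early pairs.\<close>

lemma prob_two_stage_fails_le:
  fixes p :: real
  assumes m: "0 < m" "m < n" and k: "k\<^sub>2 \<le> n - m" and p: "0 \<le> p" "p < 1"
  shows "measure_pmf.prob (random_graph n p)
      {G. card (final_set n (two_stage n m k\<^sub>1 k\<^sub>2) G) \<noteq> k\<^sub>1 + k\<^sub>2}
    \<le> real k\<^sub>1 * real m ^ k\<^sub>1 * (1 - (1 - p) ^ k\<^sub>1) ^ (m - k\<^sub>1)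
      + ((1 + (1 / (1 - p)) powr (real k\<^sub>1 + real k\<^sub>2 / 2) * real k\<^sub>2 / real (n - m)) ^ k\<^sub>2 - 1)"
proof -
  define F where "F = {G. \<exists>S\<subseteq>{1..m}. card S < k\<^sub>1 \<and> (\<forall>v\<in>{1..m} - S. \<exists>u\<in>S. {u, v} \<in> G)}"
  define Q where "Q G H \<longleftrightarrow> card (greedy k\<^sub>1 G m) = k\<^sub>1 \<and>
    \<not> (\<exists>T\<in>[{m<..n}]\<^bsup>k\<^sub>2\<^esup>. [greedy k\<^sub>1 G m \<union> T]\<^bsup>2\<^esup> \<inter> H = {})" for G H
  define x where "x = (1 / (1 - p)) powr (real k\<^sub>1 + real k\<^sub>2 / 2) * real k\<^sub>2 / real (n - m)"
  let ?A = "[{1..m}]\<^bsup>2\<^esup>" and ?B = "late_pairs n m" and ?P = "measure_pmf.prob (random_graph n p)"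
  have AB: "finite ?A" "finite ?B" "?A \<inter> ?B = {}" "[{1..n}]\<^bsup>2\<^esup> = ?A \<union> ?B"
    using m nsets_mono[of "{1..m}" "{1..n}" 2]
    by (auto simp: late_pairs_def finite_imp_finite_nsets)
  have "{G. card (final_set n (two_stage n m k\<^sub>1 k\<^sub>2) G) \<noteq> k\<^sub>1 + k\<^sub>2} \<subseteq> F \<union> {G. Q G (?B \<inter> G)}"
  proof
    fix G assume "G \<in> {G. card (final_set n (two_stage n m k\<^sub>1 k\<^sub>2) G) \<noteq> k\<^sub>1 + k\<^sub>2}"
    then have "card (greedy k\<^sub>1 G m) \<noteq> k\<^sub>1 \<or> Q G (?B \<inter> G)"
      using card_final_set_two_stage[of m n k\<^sub>1 G k\<^sub>2] m by (auto simp: Q_def)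
    then show "G \<in> F \<union> {G. Q G (?B \<inter> G)}"
    proof
      assume "card (greedy k\<^sub>1 G m) \<noteq> k\<^sub>1"
      then have "card (greedy k\<^sub>1 G m) < k\<^sub>1"
        using card_greedy_le[of k\<^sub>1 G m] by simp
      then show ?thesis
        unfolding F_def
        by (intro UnI1 CollectI exI[of _ "greedy k\<^sub>1 G m"] conjI ballI greedy_subset greedy_dominating)
    qed simp
  qed
  then have "?P {G. card (final_set n (two_stage n m k\<^sub>1 k\<^sub>2) G) \<noteq> k\<^sub>1 + k\<^sub>2} \<le> ?P (F \<union> {G. Q G (?B \<inter> G)})"
    by (intro measure_pmf.finite_measure_mono) auto
  also have "\<dots> \<le> ?P F + ?P {G. Q G (?B \<inter> G)}"
    by (intro measure_Un_le) auto
  also have "?P F \<le> real k\<^sub>1 * real m ^ k\<^sub>1 * (1 - (1 - p) ^ k\<^sub>1) ^ (m - k\<^sub>1)"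
    using prob_small_dominating_set_le[of "{1..m}" "[{1..n}]\<^bsup>2\<^esup>" p k\<^sub>1] m p
    by (simp add: F_def random_graph_eq finite_imp_finite_nsets nsets_mono)
  \<comment> \<open>\<open>Q\<close> sees the early pairs only through the greedy set, so the graph
    can be replaced by independent early and late parts.\<close>
  also have "?P {G. Q G (?B \<inter> G)}
    = measure_pmf.prob (pair_pmf (random_subset ?A p) (random_subset ?B p)) {z. Q (fst z) (snd z)}"
  proof -
    have "Q (fst z \<union> snd z) (?B \<inter> (fst z \<union> snd z)) = Q (fst z) (snd z)"
      if "z \<in> set_pmf (pair_pmf (random_subset ?A p) (random_subset ?B p))" for z
    proof -
      have "fst z \<subseteq> ?A" "snd z \<subseteq> ?B"
        using that subsetD[OF set_pmf_random_subset, of "fst z" ?A p]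
          subsetD[OF set_pmf_random_subset, of "snd z" ?B p] by (auto simp: mem_Times_iff)
      then have "?B \<inter> (fst z \<union> snd z) = snd z" "(fst z \<union> snd z) \<inter> ?A = fst z \<inter> ?A"
        using AB(3) by auto
      then show ?thesis
        unfolding Q_def using greedy_cong[of "fst z \<union> snd z" m "fst z" k\<^sub>1] by simp
    qed
    then show ?thesis
      unfolding random_graph_eq AB(4) random_subset_Un[OF AB(1-3)] measure_map_pmf
      by (intro measure_pmf.finite_measure_eq_AE) (auto simp: AE_measure_pmf_iff case_prod_unfold)
  qed
  also have "\<dots> \<le> (1 + x) ^ k\<^sub>2 - 1"
  proof (rule prob_pair_pmf_le)
    fix G
    let ?I = "greedy k\<^sub>1 G m"
    show "measure_pmf.prob (random_subset ?B p) {H. Q G H} \<le> (1 + x) ^ k\<^sub>2 - 1"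
    proof (cases "card ?I = k\<^sub>1")
      case True
      have I: "[?I]\<^bsup>2\<^esup> \<inter> ?B = {}"
        using nsets_mono[OF greedy_subset[of k\<^sub>1 G m], of 2] by (auto simp: late_pairs_def)
      have "?I \<union> {m<..n} \<subseteq> {1..n}"
        using m greedy_subset[of k\<^sub>1 G m] by fastforce
      moreover have "[?I \<union> {m<..n}]\<^bsup>2\<^esup> \<inter> ?A \<subseteq> [?I]\<^bsup>2\<^esup>"
        by (fastforce simp: nsets_def)
      ultimately have "[?I \<union> {m<..n}]\<^bsup>2\<^esup> - [?I]\<^bsup>2\<^esup> \<subseteq> ?B"
        using nsets_mono[of "?I \<union> {m<..n}" "{1..n}" 2] by (auto simp: late_pairs_def)
      moreover have "?I \<inter> {m<..n} = {}"
        using greedy_subset[of k\<^sub>1 G m] by fastforce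
      ultimately show ?thesis
        using prob_no_independent_extension_le[of ?I "{m<..n}" ?B k\<^sub>2 p] True I AB(2) m k p
        by (simp add: Q_def x_def)
    qed (use p in \<open>auto simp: Q_def x_def\<close>)
  qed (use p in \<open>auto simp: x_def\<close>)
  finally show ?thesis
    by (simp add: x_def)
qed

section \<open>Asymptotics\<close>

lemma eventually_quadratic_nonneg:
  fixes a c\<^sub>1 c\<^sub>0 :: real
  assumes "a > 0"
  shows "eventually (\<lambda>x. a * x\<^sup>2 + c\<^sub>1 * x + c\<^sub>0 \<ge> 0) at_top"
proof (rule eventually_at_top_linorderI)
  fix x assume x: "x \<ge> max 1 ((\<bar>c\<^sub>1\<bar> + \<bar>c\<^sub>0\<bar>) / a)"
  then have "\<bar>c\<^sub>1\<bar> + \<bar>c\<^sub>0\<bar> \<le> a * x"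
    using assms by (simp add: field_simps)
  then have "(\<bar>c\<^sub>1\<bar> + \<bar>c\<^sub>0\<bar>) * x \<le> a * x * x"
    using x by (intro mult_right_mono) auto
  moreover have "- \<bar>c\<^sub>1\<bar> * x \<le> c\<^sub>1 * x"
    using x by (intro mult_right_mono) auto
  moreover have "- c\<^sub>0 \<le> \<bar>c\<^sub>0\<bar> * x"
    using mult_mono[of "\<bar>c\<^sub>0\<bar>" "\<bar>c\<^sub>0\<bar>" 1 x] x by auto
  ultimately show "a * x\<^sup>2 + c\<^sub>1 * x + c\<^sub>0 \<ge> 0"
    by (simp add: power2_eq_square algebra_simps)
qed

text \<open>Replaces the integers \<open>k\<close> and \<open>m\<close> by real functions of
  \<open>n\<close>, so that a limit can be taken. It uses 1 - x <= exp (- x) and b powr (- K) = n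
  powr (- \<alpha>) / b, where \<open>K\<close> is the upper bound on \<open>k\<close>.\<close>

lemma greedy_failure_le:
  fixes b \<alpha> :: real and n m k :: nat
  assumes "b > 1" "n \<ge> 1" "m \<le> n" "real n / 2 \<le> real m"
    and k: "real k \<le> \<alpha> * log b (real n) + 1"
  shows "real k * real m ^ k * (1 - (1 / b) ^ k) ^ (m - k)
    \<le> (\<alpha> * log b (real n) + 1) * real n powr (\<alpha> * log b (real n) + 1)
      * exp (- (real n powr (- \<alpha>) / b) * (real n / 2 - (\<alpha> * log b (real n) + 1)))"
proof -
  define K where "K = \<alpha> * log b (real n) + 1"
  define x where "x = (1 / b) ^ k"
  have K: "real k \<le> K" "0 \<le> K"
    using k by (auto simp: K_def intro: order_trans[OF of_nat_0_le_iff])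
  have x: "0 \<le> x" "x \<le> 1"
    using assms(1) by (auto simp: x_def power_le_one)
  have "b powr (- K) = real n powr (- \<alpha>) / b"
  proof -
    have "b powr (- K) = (b powr log b (real n)) powr (- \<alpha>) * b powr (- 1)"
      unfolding powr_powr powr_add[symmetric] K_def by (simp add: algebra_simps)
    then show ?thesis
      using assms by (simp add: powr_minus_divide)
  qed
  moreover have "b powr (- K) \<le> x"
  proof -
    have "x = b powr (- real k)"
      using assms(1) by (simp add: x_def powr_minus_divide powr_realpow power_divide)
    then show ?thesis
      using K assms(1) by simp
  qed
  ultimately have x0: "real n powr (- \<alpha>) / b \<le> x"
    by simp
  have "(1 - x) ^ (m - k) \<le> exp (- x) ^ (m - k)"
    using x exp_ge_add_one_self[of "- x"] by (intro power_mono) auto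
  also have "\<dots> = exp (- (x * real (m - k)))"
    by (simp flip: exp_of_nat_mult add: mult.commute)
  also have "\<dots> \<le> exp (- (real n powr (- \<alpha>) / b) * (real n / 2 - K))"
  proof -
    \<comment> \<open>For small \<open>n\<close> the factor n / 2 - K may be negative; the left side
      is then at most 0.\<close>
    have "real n powr (- \<alpha>) / b * (real n / 2 - K) \<le> x * real (m - k)"
    proof (cases "real n / 2 - K \<ge> 0")
      case True
      then show ?thesis
        using assms K x0 x by (intro mult_mono) auto
    next
      case False
      then have "real n powr (- \<alpha>) / b * (real n / 2 - K) \<le> 0"
        using assms by (intro mult_nonneg_nonpos) auto
      then show ?thesis
        using x by (meson mult_nonneg_nonneg of_nat_0_le_iff order_trans)
    qed
    then show ?thesis by simp
  qed
  finally have exp: "(1 - x) ^ (m - k) \<le> exp (- (real n powr (- \<alpha>) / b) * (real n / 2 - K))" .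
  have "real m ^ k \<le> real n ^ k"
    using assms by (intro power_mono) auto
  also have "\<dots> = real n powr real k"
    using assms by (simp add: powr_realpow)
  also have "\<dots> \<le> real n powr K"
    using assms K by (intro powr_mono) auto
  finally have "real m ^ k \<le> real n powr K" .
  then have "real k * real m ^ k * (1 - x) ^ (m - k)
    \<le> K * real n powr K * exp (- (real n powr (- \<alpha>) / b) * (real n / 2 - K))"
    using exp K x by (intro mult_mono) auto
  then show ?thesis
    by (simp only: K_def x_def)
qed

text \<open>Besides 1 + y <= exp y, the point is that k1 + k2 / 2 is half the sum of k1 and k1 + k2.
  This produces the exponent (\<alpha> + \<beta>) / 2 of \<open>n\<close>, against the denominator
  of order \<open>n\<close>.\<close>

lemma extension_failure_le:
  fixes b \<alpha> \<beta> :: real and n N k\<^sub>1 k\<^sub>2 :: nat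
  assumes "b > 1" "n \<ge> 2" "(real n - 1) / 2 \<le> real N"
    and k1: "real k\<^sub>1 \<le> \<alpha> * log b (real n) + 1"
    and k: "real (k\<^sub>1 + k\<^sub>2) \<le> \<beta> * log b (real n) + 1"
  shows "(1 + b powr (real k\<^sub>1 + real k\<^sub>2 / 2) * real k\<^sub>2 / real N) ^ k\<^sub>2 - 1
    \<le> exp (b * real n powr ((\<alpha> + \<beta>) / 2) * (\<beta> * log b (real n) + 1)\<^sup>2 / ((real n - 1) / 2)) - 1"
proof -
  define y where "y = b powr (real k\<^sub>1 + real k\<^sub>2 / 2) * real k\<^sub>2 / real N"
  have "y \<ge> 0"
    by (simp add: y_def)
  then have "(1 + y) ^ k\<^sub>2 \<le> exp y ^ k\<^sub>2"
    using exp_ge_add_one_self[of y] by (intro power_mono) auto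
  also have "\<dots> = exp (b powr (real k\<^sub>1 + real k\<^sub>2 / 2) * (real k\<^sub>2)\<^sup>2 / real N)"
    by (simp flip: exp_of_nat_mult add: y_def power2_eq_square mult_ac)
  also have "\<dots> \<le> exp (b * real n powr ((\<alpha> + \<beta>) / 2) * (\<beta> * log b (real n) + 1)\<^sup>2 / ((real n - 1) / 2))"
  proof -
    have "2 * real k\<^sub>1 + real k\<^sub>2 \<le> \<alpha> * log b (real n) + \<beta> * log b (real n) + 2"
      using k1 k by simp
    then have "real k\<^sub>1 + real k\<^sub>2 / 2 \<le> log b (real n) * ((\<alpha> + \<beta>) / 2) + 1"
      by (simp add: field_simps)
    then have "b powr (real k\<^sub>1 + real k\<^sub>2 / 2) \<le> b powr (log b (real n) * ((\<alpha> + \<beta>) / 2) + 1)"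
      using assms by (intro powr_mono) auto
    also have "\<dots> = b * real n powr ((\<alpha> + \<beta>) / 2)"
      unfolding powr_add powr_powr[symmetric] using assms by simp
    finally have "b powr (real k\<^sub>1 + real k\<^sub>2 / 2) \<le> b * real n powr ((\<alpha> + \<beta>) / 2)" .
    moreover have "(real k\<^sub>2)\<^sup>2 \<le> (\<beta> * log b (real n) + 1)\<^sup>2"
      using k by (intro power_mono) auto
    ultimately show ?thesis
      using assms by (subst exp_le_cancel_iff) (intro frac_le mult_mono mult_nonneg_nonneg, simp_all)
  qed
  finally show ?thesis
    by (simp add: y_def)
qed

text \<open>The first two factors grow like the exponential of a multiple of log(n)^2, while the
  last decays like the exponential of a negative multiple of n powr (1 - \<alpha>).\<close>

lemma greedy_failure_tendsto_0:
  fixes b \<alpha> :: real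
  assumes "b > 1" "0 < \<alpha>" "\<alpha> < 1"
  shows "(\<lambda>n. (\<alpha> * log b (real n) + 1) * real n powr (\<alpha> * log b (real n) + 1)
    * exp (- (real n powr (- \<alpha>) / b) * (real n / 2 - (\<alpha> * log b (real n) + 1)))) \<longlonglongrightarrow> 0"
  unfolding log_def using assms by real_asymp

lemma extension_failure_tendsto_0:
  fixes b \<gamma> \<beta> :: real
  assumes "b > 1" "\<gamma> < 1" "\<beta> > 0"
  shows "(\<lambda>n. exp (b * real n powr \<gamma> * (\<beta> * log b (real n) + 1)\<^sup>2 / ((real n - 1) / 2)) - 1) \<longlonglongrightarrow> 0"
  unfolding log_def using assms by real_asymp

text \<open>The left side bounds the number of pairs meeting the extension. Twice the difference of
  the two sides is a quadratic in \<open>log b n\<close> with positive leading coefficient 2 * c -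
  (\<beta>^2 - \<alpha>^2); \<open>d\<close> will be \<open>log b p\<close>.\<close>

lemma eventually_pair_bound:
  fixes b \<alpha> \<beta> c d :: real
  assumes b: "b > 1" and \<alpha>: "0 < \<alpha>" and c: "\<beta>\<^sup>2 - \<alpha>\<^sup>2 < 2 * c"
  shows "\<forall>\<^sub>F n in sequentially.
    (\<beta> * log b (real n) + 1)\<^sup>2 / 2 - ((\<alpha> * log b (real n))\<^sup>2 - \<alpha> * log b (real n) - 1) / 2
      \<le> c * (log b (real n) + d)\<^sup>2"
proof -
  have lim: "filterlim (\<lambda>n. log b (real n)) at_top sequentially"
    unfolding log_def using b by real_asymp
  have "\<forall>\<^sub>F x in at_top. (2 * c - (\<beta>\<^sup>2 - \<alpha>\<^sup>2)) * x\<^sup>2 + (4 * c * d - 2 * \<beta> - \<alpha>) * x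
      + (2 * c * d\<^sup>2 - 2) \<ge> 0"
    using c by (intro eventually_quadratic_nonneg) auto
  from eventually_compose_filterlim[OF this lim]
  have "\<forall>\<^sub>F n in sequentially. (2 * c - (\<beta>\<^sup>2 - \<alpha>\<^sup>2)) * (log b (real n))\<^sup>2
      + (4 * c * d - 2 * \<beta> - \<alpha>) * log b (real n) + (2 * c * d\<^sup>2 - 2) \<ge> 0"
    .
  then show ?thesis
    by eventually_elim (simp add: power2_eq_square field_simps)
qed

theorem theorem2p3:
  fixes p \<epsilon> :: real
  assumes "0 < p" and "p < 1" and "0 < \<epsilon>" and "\<epsilon> < 1"
  shows "\<exists>\<A> :: nat \<Rightarrow> strategy.
    (\<forall>n\<ge>1. online_algorithm n (\<A> n) \<and> restricted (3 * \<epsilon>) n p (\<A> n)) \<and>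
    (\<lambda>n. measure_pmf.prob (random_graph n p)
            {G. real (card (final_set n (\<A> n) G)) \<ge> (1 + \<epsilon>) * log (1 / (1 - p)) (real n)})
      \<longlonglongrightarrow> 1"
proof -
  define b where "b = 1 / (1 - p)"
  have b: "b > 1" "1 - p = 1 / b"
    using assms by (auto simp: b_def)
  \<comment> \<open>\<epsilon> < \<delta> gives (\<alpha> + \<beta>) / 2 < 1 for the second moment,
    \<delta> < 2 * \<epsilon> gives the query bound, and \<delta> < 1 keeps \<alpha>
    positive.\<close>
  obtain \<delta> where \<delta>: "\<epsilon> < \<delta>" "\<delta> < 2 * \<epsilon>" "\<delta> < 1"
    using dense[of \<epsilon> "min (2 * \<epsilon>) 1"] assms by auto
  define \<alpha> \<beta> where "\<alpha> = 1 - \<delta>" and "\<beta> = 1 + \<epsilon>"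
  have \<alpha>\<beta>: "0 < \<alpha>" "\<alpha> < 1" "\<alpha> \<le> \<beta>" "0 < \<beta>" "(\<alpha> + \<beta>) / 2 < 1"
    using \<delta> assms by (auto simp: \<alpha>_def \<beta>_def)
  \<comment> \<open>The product is (\<beta> - \<alpha>) * (\<beta> + \<alpha>).\<close>
  have "(\<epsilon> + \<delta>) * (2 + \<epsilon> - \<delta>) < (3 * \<epsilon>) * 2"
    using \<delta> assms by (intro mult_strict_mono) auto
  then have c: "\<beta>\<^sup>2 - \<alpha>\<^sup>2 < 2 * (3 * \<epsilon>)"
    by (simp add: \<alpha>_def \<beta>_def power2_eq_square algebra_simps)
  \<comment> \<open>Rounding up makes \<open>k n\<close> reach the target size. The choice of
    \<open>m\<close> leaves n div 2 vertices for the extension and stays positive for n = 1.\<close>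
  define k\<^sub>1 k m where "k\<^sub>1 n = nat \<lceil>\<alpha> * log b (real n)\<rceil>" and "k n = nat \<lceil>\<beta> * log b (real n)\<rceil>"
    and "m n = n - n div 2" for n
  define query_bound where "query_bound n \<longleftrightarrow> real ((k n choose 2) - (k\<^sub>1 n choose 2)) \<le> 3 * \<epsilon> * (log b (real n * p))\<^sup>2" for n
  \<comment> \<open>For the finitely many \<open>n\<close> where the query bound fails, the algorithm accepts nothing.\<close>
  define \<A> where "\<A> n = (if query_bound n then two_stage n (m n) (k\<^sub>1 n) (k n - k\<^sub>1 n) else two_stage n (m n) 0 0)" for n
  have k1: "\<alpha> * log b (real n) \<le> real (k\<^sub>1 n)" "real (k\<^sub>1 n) \<le> \<alpha> * log b (real n) + 1"
    and k: "\<beta> * log b (real n) \<le> real (k n)" "real (k n) \<le> \<beta> * log b (real n) + 1"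
    and le: "k\<^sub>1 n \<le> k n" if "n \<ge> 1" for n
  proof -
    have L: "0 \<le> log b (real n)"
      using b that by simp
    then have "0 \<le> \<alpha> * log b (real n)" "0 \<le> \<beta> * log b (real n)"
      using \<alpha>\<beta> by simp_all
    then show "\<alpha> * log b (real n) \<le> real (k\<^sub>1 n)" "real (k\<^sub>1 n) \<le> \<alpha> * log b (real n) + 1"
      "\<beta> * log b (real n) \<le> real (k n)" "real (k n) \<le> \<beta> * log b (real n) + 1"
      unfolding k\<^sub>1_def k_def by linarith+
    show "k\<^sub>1 n \<le> k n"
      using L \<alpha>\<beta>(3) unfolding k\<^sub>1_def k_def by (intro nat_mono ceiling_mono mult_right_mono)
  qed
  have m: "0 < m n" "m n \<le> n" if "n \<ge> 1" for n
    using that by (auto simp: m_def)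
  have div2: "(real n - 1) / 2 \<le> real (n div 2)" "real (n div 2) \<le> real n / 2" for n
    using of_nat_mono[of n "2 * (n div 2) + 1", where 'a = real]
      of_nat_mono[of "2 * (n div 2)" n, where 'a = real] by simp_all
  have legal: "online_algorithm n (\<A> n) \<and> restricted (3 * \<epsilon>) n p (\<A> n)" if "n \<ge> 1" for n
    using online_algorithm_two_stage[OF m[OF that]] restricted_two_stage[OF m[OF that], where p = p]
      le[OF that] assms by (auto simp: \<A>_def query_bound_def b_def)
  have "\<forall>\<^sub>F n in sequentially. (\<beta> * log b (real n) + 1)\<^sup>2 / 2
      - ((\<alpha> * log b (real n))\<^sup>2 - \<alpha> * log b (real n) - 1) / 2 \<le> 3 * \<epsilon> * (log b (real n) + log b p)\<^sup>2"
    by (rule eventually_pair_bound[OF b(1) \<alpha>\<beta>(1) c])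
  then have "\<forall>\<^sub>F n in sequentially. query_bound n"
    using eventually_ge_at_top[of 1]
  proof eventually_elim
    case (elim n)
    have pos: "0 \<le> \<alpha> * log b (real n)"
      using b \<alpha>\<beta> elim by simp
    have "(real (k n))\<^sup>2 \<le> (\<beta> * log b (real n) + 1)\<^sup>2"
      using k[OF elim(2)] by (intro power_mono) auto
    then have "real (k n choose 2) \<le> (\<beta> * log b (real n) + 1)\<^sup>2 / 2"
      by (simp add: real_choose_two power2_eq_square right_diff_distrib)
    moreover have "(\<alpha> * log b (real n))\<^sup>2 \<le> (real (k\<^sub>1 n))\<^sup>2"
      using k1[OF elim(2)] pos by (intro power_mono) auto
    then have "((\<alpha> * log b (real n))\<^sup>2 - \<alpha> * log b (real n) - 1) / 2 \<le> real (k\<^sub>1 n choose 2)"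
      using k1(2)[OF elim(2)] by (simp add: real_choose_two power2_eq_square right_diff_distrib)
    ultimately have "real (k n choose 2) - real (k\<^sub>1 n choose 2) \<le> 3 * \<epsilon> * (log b (real n) + log b p)\<^sup>2"
      by (rule order_trans[OF diff_mono elim(1)])
    moreover have "log b (real n * p) = log b (real n) + log b p"
      using elim b assms by (simp add: log_mult)
    moreover have "real ((k n choose 2) - (k\<^sub>1 n choose 2)) = real (k n choose 2) - real (k\<^sub>1 n choose 2)"
      using le[OF elim(2)] by (intro of_nat_diff binomial_right_mono)
    ultimately show ?case
      by (simp only: query_bound_def)
  qed
  \<comment> \<open>This ensures that enough vertices remain beyond \<open>m n\<close> to hold an
    extension of the required size.\<close>
  moreover have "\<forall>\<^sub>F n in sequentially. \<beta> * log b (real n) + 1 \<le> (real n - 1) / 2"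
    unfolding log_def using b \<alpha>\<beta> by real_asymp
  ultimately have good: "\<forall>\<^sub>F n in sequentially. n \<ge> 2 \<and> query_bound n \<and> k n - k\<^sub>1 n \<le> n - m n"
    using eventually_ge_at_top[of 2]
  proof eventually_elim
    case (elim n)
    have "real (k n) \<le> real (n div 2)"
      using k(2)[of n] div2(1)[of n] elim by simp
    then show ?case
      using elim by (auto simp: m_def)
  qed
  define f where "f n = (\<alpha> * log b (real n) + 1) * real n powr (\<alpha> * log b (real n) + 1)
      * exp (- (real n powr (- \<alpha>) / b) * (real n / 2 - (\<alpha> * log b (real n) + 1)))
    + (exp (b * real n powr ((\<alpha> + \<beta>) / 2) * (\<beta> * log b (real n) + 1)\<^sup>2 / ((real n - 1) / 2)) - 1)" for n
  have "f \<longlonglongrightarrow> 0 + 0"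
    unfolding f_def using b \<alpha>\<beta>
    by (intro tendsto_add greedy_failure_tendsto_0 extension_failure_tendsto_0) auto
  then have lim: "(\<lambda>n. 1 - f n) \<longlonglongrightarrow> 1"
    using tendsto_diff[OF tendsto_const, of f 0 _ 1] by simp
  have lower: "\<forall>\<^sub>F n in sequentially. 1 - f n \<le> measure_pmf.prob (random_graph n p)
      {G. real (card (final_set n (\<A> n) G)) \<ge> \<beta> * log b (real n)}"
    using good
  proof eventually_elim
    case (elim n)
    let ?a = "two_stage n (m n) (k\<^sub>1 n) (k n - k\<^sub>1 n)" and ?P = "measure_pmf.prob (random_graph n p)"
    have n: "1 \<le> n"
      using elim by simp
    have half: "real n / 2 \<le> real (m n)" "(real n - 1) / 2 \<le> real (n - m n)"
      using div2[of n] by (simp_all add: m_def of_nat_diff)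
    have "?P {G. card (final_set n ?a G) \<noteq> k\<^sub>1 n + (k n - k\<^sub>1 n)} \<le> f n"
    proof (rule order_trans[OF prob_two_stage_fails_le])
      show "real (k\<^sub>1 n) * real (m n) ^ k\<^sub>1 n * (1 - (1 - p) ^ k\<^sub>1 n) ^ (m n - k\<^sub>1 n)
        + ((1 + (1 / (1 - p)) powr (real (k\<^sub>1 n) + real (k n - k\<^sub>1 n) / 2) * real (k n - k\<^sub>1 n) / real (n - m n))
            ^ (k n - k\<^sub>1 n) - 1) \<le> f n"
        unfolding b(2) divide_divide_eq_right mult_1 div_by_1 unfolding f_def
        by (rule add_mono[OF greedy_failure_le[OF b(1) n m(2)[OF n] half(1) k1(2)[OF n]]
          extension_failure_le[OF b(1) elim[THEN conjunct1] half(2) k1(2)[OF n]]])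
          (use k(2)[OF n] le[OF n] in simp)
    qed (use elim m[OF n] assms in \<open>auto simp: m_def\<close>)
    moreover have "{G. card (final_set n ?a G) = k n}
        = space (random_graph n p) - {G. card (final_set n ?a G) \<noteq> k\<^sub>1 n + (k n - k\<^sub>1 n)}"
      using le[OF n] by auto
    then have "?P {G. card (final_set n ?a G) = k n}
        = 1 - ?P {G. card (final_set n ?a G) \<noteq> k\<^sub>1 n + (k n - k\<^sub>1 n)}"
      by (simp only: measure_pmf.prob_compl sets_measure_pmf UNIV_I Pow_UNIV)
    moreover have "?P {G. card (final_set n ?a G) = k n}
        \<le> ?P {G. real (card (final_set n (\<A> n) G)) \<ge> \<beta> * log b (real n)}"
      using k(1)[OF n] elim by (intro measure_pmf.finite_measure_mono) (auto simp: \<A>_def)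
    ultimately show ?case
      by linarith
  qed
  have "(\<lambda>n. measure_pmf.prob (random_graph n p)
      {G. real (card (final_set n (\<A> n) G)) \<ge> \<beta> * log b (real n)}) \<longlonglongrightarrow> 1"
    by (rule tendsto_sandwich[OF lower _ lim tendsto_const]) simp
  then show ?thesis
    using legal unfolding \<beta>_def b_def by blast
qed

end
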